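(* Let $A, B \in \mathbb{P}_{2}$ with determinants $1$ and let $t \in [0,1]$. Then $$A \natural_{t} B = \frac{(A^{-1} + B)^{t} A (A^{-1} + B)^{t}}{[ 2 + \mathrm{tr} (A B) ]^{t}}.$$
   Context: $\mathbb{P}_{2}$ is the set of $2 \times 2$ positive definite Hermitian complex matrices. The geometric mean is $A \# B := A^{1/2} (A^{-1/2} B A^{-1/2})^{1/2} A^{1/2}$ and the weighted spectral geometric mean is $A \natural_{t} B := (A^{-1} \# B)^{t} A (A^{-1} \# B)^{t}$ for $t \in [0,1]$. *)

theory Defs
  imports "HOL-Analysis.Analysis"
begin

definition conj_transpose :: "complex^'n^'m \<Rightarrow> complex^'m^'n" where
  "conj_transpose A = (\<chi> i j. cnj (A $ j $ i))"

definition hermitian_mat :: "complex^'n^'n \<Rightarrow> bool" where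
  "hermitian_mat A \<longleftrightarrow> conj_transpose A = A"

definition unitary_mat :: "complex^'n^'n \<Rightarrow> bool" where
  "unitary_mat U \<longleftrightarrow> conj_transpose U ** U = mat 1 \<and> U ** conj_transpose U = mat 1"

text \<open>The form \<open>x\<^sup>* A x\<close> is real because \<open>A\<close> is Hermitian, so taking \<open>Re\<close> loses nothing.\<close>

definition pos_def_mats :: "(complex^'n^'n) set" where
  "pos_def_mats = {A. hermitian_mat A \<and>
     (\<forall>x. x \<noteq> 0 \<longrightarrow> 0 < Re (\<Sum>i\<in>UNIV. cnj (x $ i) * (A *v x) $ i))}"

definition diag_mat :: "('n \<Rightarrow> real) \<Rightarrow> complex^'n^'n" where
  "diag_mat d = (\<chi> i j. if i = j then complex_of_real (d i) else 0)"

text \<open>Real powers by the spectral functional calculus: if \<open>A = U diag(d) U\<^sup>*\<close> with \<open>U\<close>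
  unitary and \<open>d > 0\<close>, then \<open>A\<^sup>t = U diag(d\<^sup>t) U\<^sup>*\<close>. The description is independent
  of the chosen diagonalization (lemma \<open>mat_powr_eq\<close>); the value is meaningful
  only for positive definite \<open>A\<close>.\<close>

definition mat_powr :: "complex^'n^'n \<Rightarrow> real \<Rightarrow> complex^'n^'n" where
  "mat_powr A t = (THE X. \<exists>U d. unitary_mat U \<and> (\<forall>i. 0 < d i) \<and>
     A = U ** diag_mat d ** conj_transpose U \<and>
     X = U ** diag_mat (\<lambda>i. d i powr t) ** conj_transpose U)"

lemma matrix_mult_diag_mat:
  "(M ** diag_mat d) $ i $ j = M $ i $ j * complex_of_real (d j)"
  "(diag_mat d ** M) $ i $ j = complex_of_real (d i) * M $ i $ j"
  by (simp_all add: matrix_matrix_mult_def diag_mat_def if_distrib if_distribR cong: if_cong)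

lemma mat_powr_eq:
  assumes U: "unitary_mat U" and d: "\<forall>i. 0 < d i"
    and A: "A = U ** diag_mat d ** conj_transpose U"
  shows "mat_powr A t = U ** diag_mat (\<lambda>i. d i powr t) ** conj_transpose U"
  unfolding mat_powr_def
proof (rule the_equality)
  show "\<exists>U' d'. unitary_mat U' \<and> (\<forall>i. 0 < d' i) \<and> A = U' ** diag_mat d' ** conj_transpose U' \<and>
     U ** diag_mat (\<lambda>i. d i powr t) ** conj_transpose U =
     U' ** diag_mat (\<lambda>i. d' i powr t) ** conj_transpose U'"
    using assms by blast
next
  fix X
  assume "\<exists>V e. unitary_mat V \<and> (\<forall>i. 0 < e i) \<and> A = V ** diag_mat e ** conj_transpose V \<and>
     X = V ** diag_mat (\<lambda>i. e i powr t) ** conj_transpose V"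
  then obtain V e where V: "unitary_mat V" and e: "\<forall>i. 0 < e i"
    and A': "A = V ** diag_mat e ** conj_transpose V"
    and X: "X = V ** diag_mat (\<lambda>i. e i powr t) ** conj_transpose V" by blast
  define W where "W = conj_transpose V ** U"
  have VW: "V ** W = U"
    using V by (simp add: W_def unitary_mat_def matrix_mul_assoc)
  have WU: "W ** conj_transpose U = conj_transpose V"
    using U by (simp add: W_def unitary_mat_def flip: matrix_mul_assoc)
  have "conj_transpose V ** A ** U = W ** diag_mat d"
    using U unfolding A W_def unitary_mat_def by (metis matrix_mul_assoc matrix_mul_rid)
  moreover have "conj_transpose V ** A ** U = diag_mat e ** W"
    using V unfolding A' W_def unitary_mat_def by (metis matrix_mul_assoc matrix_mul_lid)
  ultimately have eq: "W ** diag_mat d = diag_mat e ** W" by simp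
  have "W $ i $ j * of_real (d j powr t) = of_real (e i powr t) * W $ i $ j" for i j
  proof -
    have "W $ i $ j * of_real (d j) = of_real (e i) * W $ i $ j"
      using arg_cong[OF eq, of "\<lambda>M. M $ i $ j"] by (simp add: matrix_mult_diag_mat)
    then have "W $ i $ j = 0 \<or> d j = e i" by (auto simp: mult.commute)
    then show ?thesis by auto
  qed
  then have eq': "W ** diag_mat (\<lambda>i. d i powr t) = diag_mat (\<lambda>i. e i powr t) ** W"
    by (simp add: vec_eq_iff matrix_mult_diag_mat)
  show "X = U ** diag_mat (\<lambda>i. d i powr t) ** conj_transpose U"
    unfolding X by (metis VW WU eq' matrix_mul_assoc)
qed

definition geom_mean :: "complex^'n^'n \<Rightarrow> complex^'n^'n \<Rightarrow> complex^'n^'n" where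
  "geom_mean A B = mat_powr A (1/2) **
     mat_powr (mat_powr A (-1/2) ** B ** mat_powr A (-1/2)) (1/2) ** mat_powr A (1/2)"

definition spectral_geom_mean ::
  "real \<Rightarrow> complex^'n^'n \<Rightarrow> complex^'n^'n \<Rightarrow> complex^'n^'n" where
  "spectral_geom_mean t A B =
     mat_powr (geom_mean (matrix_inv A) B) t ** A ** mat_powr (geom_mean (matrix_inv A) B) t"

end

theory Submission
  imports Defs
begin

text \<open>A positive definite \<open>2 \<times> 2\<close> matrix \<open>M\<close> of determinant \<open>1\<close> has eigenvalues \<open>d, 1/d\<close>, and
  \<open>sqrt d = (d + 1) / sqrt (2 + d + 1/d)\<close>; hence \<open>M\<^sup>1\<^sup>/\<^sup>2 = (M + I) / sqrt (2 + tr M)\<close>.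
  Applied to \<open>M = C\<^sup>-\<^sup>1\<^sup>/\<^sup>2 B C\<^sup>-\<^sup>1\<^sup>/\<^sup>2\<close> with \<open>C = A\<^sup>-\<^sup>1\<close>, whose trace is \<open>tr (A B)\<close>, this shows that
  \<open>A\<^sup>-\<^sup>1 # B\<close> is \<open>A\<^sup>-\<^sup>1 + B\<close> scaled by \<open>1 / sqrt (2 + tr (A B))\<close>, and powers are
  homogeneous under positive scaling.\<close>

section \<open>Matrix algebra: adjoints, diagonal matrices, scaling, inverses\<close>

lemma conj_transpose_mult:
  "conj_transpose (A ** B) = conj_transpose B ** conj_transpose A"
  by (simp add: conj_transpose_def matrix_matrix_mult_def vec_eq_iff mult.commute)

lemma conj_transpose_conj_transpose [simp]: "conj_transpose (conj_transpose A) = A"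
  by (simp add: conj_transpose_def vec_eq_iff)

lemma conj_transpose_diag_mat [simp]: "conj_transpose (diag_mat d) = diag_mat d"
  by (auto simp: conj_transpose_def diag_mat_def vec_eq_iff)

lemma diag_mat_mult: "diag_mat d ** diag_mat e = diag_mat (\<lambda>i. d i * e i)"
  by (simp add: vec_eq_iff matrix_mult_diag_mat) (simp add: diag_mat_def)

lemma diag_mat_1 [simp]: "diag_mat (\<lambda>i. 1) = mat 1"
  by (simp add: diag_mat_def mat_def vec_eq_iff)

lemma matrix_mult_scaleR:
  fixes M N :: "complex^'n^'n"
  shows "(c *\<^sub>R M) ** N = c *\<^sub>R (M ** N)" and "M ** (c *\<^sub>R N) = c *\<^sub>R (M ** N)"
  by (simp_all add: vec_eq_iff matrix_matrix_mult_def scaleR_sum_right)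

lemma matrix_add_rdistrib: "(A + B) ** C = A ** C + B ** C"
  by (simp add: vec_eq_iff matrix_matrix_mult_def distrib_right sum.distrib)

lemma matrix_inv_unique:
  assumes "A ** B = mat 1" and "B ** A = mat 1"
  shows "matrix_inv A = B"
proof -
  \<comment> \<open>\<open>matrix_inv\<close> is a Hilbert choice, so a witness is needed before
    anything is known about it; \<open>B\<close> is that witness.\<close>
  have "A ** matrix_inv A = mat 1 \<and> matrix_inv A ** A = mat 1"
    unfolding matrix_inv_def by (rule someI[of _ B]) (simp add: assms)
  then show ?thesis
    by (metis assms(1) matrix_mul_assoc matrix_mul_lid matrix_mul_rid)
qed

lemma unitary_conj_mult:
  assumes "unitary_mat U"
  shows "(U ** M ** conj_transpose U) ** (U ** N ** conj_transpose U) =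
    U ** (M ** N) ** conj_transpose U"
  using assms unfolding unitary_mat_def by (metis matrix_mul_assoc matrix_mul_rid)

section \<open>Positive definiteness through the form x* A x\<close>

definition sesq_form :: "complex^'n^'n \<Rightarrow> complex^'n \<Rightarrow> complex^'n \<Rightarrow> complex" where
  "sesq_form A x y = (\<Sum>i\<in>UNIV. cnj (x $ i) * (A *v y) $ i)"

lemma sesq_form_congruence:
  "sesq_form (conj_transpose S ** M ** S) x x = sesq_form M (S *v x) (S *v x)"
proof -
  \<comment> \<open>The adjoint moves across the inner product: (x, S* y) = (S x, y).\<close>
  have adj: "(\<Sum>i\<in>UNIV. cnj (x $ i) * (conj_transpose S *v y) $ i) =
      (\<Sum>j\<in>UNIV. cnj ((S *v x) $ j) * y $ j)" for y
  proof -
    have "(\<Sum>i\<in>UNIV. cnj (x $ i) * (conj_transpose S *v y) $ i) =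
        (\<Sum>i\<in>UNIV. \<Sum>j\<in>UNIV. cnj (x $ i) * (cnj (S $ j $ i) * y $ j))"
      by (simp add: matrix_vector_mult_def conj_transpose_def sum_distrib_left)
    also have "\<dots> = (\<Sum>j\<in>UNIV. \<Sum>i\<in>UNIV. cnj (x $ i) * (cnj (S $ j $ i) * y $ j))"
      by (rule sum.swap)
    also have "\<dots> = (\<Sum>j\<in>UNIV. cnj ((S *v x) $ j) * y $ j)"
      unfolding matrix_vector_mult_def vec_lambda_beta cnj_sum sum_distrib_right complex_cnj_mult
      by (simp only: mult_ac)
    finally show ?thesis .
  qed
  show ?thesis
    unfolding sesq_form_def by (simp add: adj flip: matrix_vector_mul_assoc)
qed

lemma pos_def_mats_iff:
  "A \<in> pos_def_mats \<longleftrightarrow> conj_transpose A = A \<and> (\<forall>x. x \<noteq> 0 \<longrightarrow> 0 < Re (sesq_form A x x))"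
  by (simp add: pos_def_mats_def hermitian_mat_def sesq_form_def)

text \<open>The left inverse \<open>R\<close> makes \<open>S\<close> injective, so the form of
  \<open>M\<close> is only evaluated at nonzero vectors \<open>S *v x\<close>.\<close>

lemma pos_def_mats_congruence:
  assumes M: "M \<in> pos_def_mats" and S: "R ** S = mat 1"
  shows "conj_transpose S ** M ** S \<in> pos_def_mats"
proof -
  have "S *v x \<noteq> 0" if "x \<noteq> 0" for x
    using that by (metis S matrix_vector_mul_assoc matrix_vector_mul_lid matrix_vector_mult_0_right)
  then show ?thesis
    using M by (auto simp: pos_def_mats_iff sesq_form_congruence conj_transpose_mult matrix_mul_assoc)
qed

lemma pos_def_mats_add:
  assumes "A \<in> pos_def_mats" and "B \<in> pos_def_mats"
  shows "A + B \<in> pos_def_mats"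
proof -
  have "conj_transpose (A + B) = conj_transpose A + conj_transpose B"
    by (simp add: conj_transpose_def vec_eq_iff)
  moreover have "sesq_form (A + B) x x = sesq_form A x x + sesq_form B x x" for x
    by (simp add: sesq_form_def matrix_vector_mult_add_rdistrib distrib_left sum.distrib)
  ultimately show ?thesis
    using assms by (simp add: pos_def_mats_iff add_pos_pos)
qed

lemma sesq_form_diag_mat:
  "sesq_form (diag_mat d) x x = of_real (\<Sum>i\<in>UNIV. d i * (cmod (x $ i))\<^sup>2)"
proof -
  have "cnj (x $ i) * (diag_mat d *v x) $ i = of_real (d i * (cmod (x $ i))\<^sup>2)" for i
  proof -
    have "(diag_mat d *v x) $ i = of_real (d i) * x $ i"
      by (simp add: matrix_vector_mult_def diag_mat_def if_distrib if_distribR cong: if_cong)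
    then show ?thesis
      by (simp add: complex_norm_square mult_ac del: of_real_power)
  qed
  then show ?thesis
    by (simp add: sesq_form_def)
qed

lemma diag_mat_pos_def_iff: "diag_mat d \<in> pos_def_mats \<longleftrightarrow> (\<forall>i. 0 < d i)"
proof
  assume L: "diag_mat d \<in> pos_def_mats"
  show "\<forall>i. 0 < d i"
  proof
    fix i
    \<comment> \<open>Testing the form on the i-th standard basis vector isolates
      \<open>d i\<close>.\<close>
    have "(\<Sum>j\<in>UNIV. d j * (cmod ((axis i 1 :: complex^'a) $ j))\<^sup>2) =
        (\<Sum>j\<in>UNIV. if j = i then d j else 0)"
      by (intro sum.cong) (auto simp: axis_def)
    then have "(\<Sum>j\<in>UNIV. d j * (cmod ((axis i 1 :: complex^'a) $ j))\<^sup>2) = d i"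
      by simp
    moreover have "(axis i 1 :: complex^'a) \<noteq> 0"
      by (simp add: axis_eq_0_iff)
    ultimately show "0 < d i"
      using L unfolding pos_def_mats_iff sesq_form_diag_mat by (metis Re_complex_of_real)
  qed
next
  assume d: "\<forall>i. 0 < d i"
  have "0 < (\<Sum>i\<in>UNIV. d i * (cmod (x $ i))\<^sup>2)" if x: "x \<noteq> 0" for x :: "complex^'a"
  proof -
    obtain i where "x $ i \<noteq> 0"
      using x by (auto simp: vec_eq_iff)
    then show ?thesis
      using d by (intro sum_pos2[of _ i]) (simp_all add: less_imp_le)
  qed
  then show "diag_mat d \<in> pos_def_mats"
    by (simp add: pos_def_mats_iff sesq_form_diag_mat)
qed

lemma unitary_diag_pos_def:
  assumes U: "unitary_mat U" and d: "\<forall>i. 0 < d i"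
  shows "U ** diag_mat d ** conj_transpose U \<in> pos_def_mats"
  using pos_def_mats_congruence[of "diag_mat d" U "conj_transpose U"] U d
  by (simp add: diag_mat_pos_def_iff unitary_mat_def)

section \<open>Unitary diagonalization in dimension two\<close>

text \<open>In dimension two the quadratic formula gives one eigenvector explicitly, and the
  orthogonal direction gives the other.\<close>

lemma hermitian_2_diagonalizable:
  fixes H :: "complex^2^2"
  assumes "hermitian_mat H"
  obtains U d where "unitary_mat U" and "H = U ** diag_mat d ** conj_transpose U"
proof -
  define a b c where "a = Re (H $ 1 $ 1)" and "b = H $ 1 $ 2" and "c = Re (H $ 2 $ 2)"
  have H: "cnj (H $ j $ i) = H $ i $ j" for i j
    using assms by (auto simp: hermitian_mat_def conj_transpose_def vec_eq_iff)
  have H11: "H $ 1 $ 1 = of_real a" and H22: "H $ 2 $ 2 = of_real c"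
    using H[of 1 1] H[of 2 2] by (simp_all add: a_def c_def complex_eq_iff)
  have H21: "H $ 2 $ 1 = cnj b"
    using H[of 1 2] by (simp add: b_def)
  note H_entries = H11 H22 H21 b_def[symmetric]
  have "\<exists>U d. unitary_mat U \<and> H ** U = U ** diag_mat d"
  proof (cases "b = 0")
    case True
    have "H = diag_mat (\<lambda>i. if i = 1 then a else c)"
      using True by (simp add: vec_eq_iff forall_2 diag_mat_def H_entries)
    moreover have "unitary_mat (mat 1 :: complex^2^2)"
      by (simp add: unitary_mat_def conj_transpose_def mat_def vec_eq_iff forall_2
          matrix_matrix_mult_def sum_2)
    ultimately show ?thesis
      by (metis matrix_mul_lid matrix_mul_rid)
  next
    case False
    text \<open>\<open>m + a\<close> is the larger eigenvalue, with eigenvector \<open>(b, m)\<close>.\<close>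
    define m where "m = (c - a + sqrt ((a - c)\<^sup>2 + 4 * (cmod b)\<^sup>2)) / 2"
    \<comment> \<open>The length of (b, m), positive because b is nonzero; (p, q) is then a unit
      eigenvector.\<close>
    define n where "n = sqrt ((cmod b)\<^sup>2 + m\<^sup>2)"
    define p q where "p = b / of_real n" and "q = m / n"
    have "2 * m - (c - a) = sqrt ((a - c)\<^sup>2 + 4 * (cmod b)\<^sup>2)"
      by (simp only: m_def) (simp add: field_simps)
    then have "(2 * m - (c - a))\<^sup>2 = (a - c)\<^sup>2 + 4 * (cmod b)\<^sup>2"
      by simp
    \<comment> \<open>The second row of the eigenvector equation: |b|^2 + c m = (m + a) m.\<close>
    then have mb: "m * (m + a - c) = (cmod b)\<^sup>2"
      by (simp add: power2_eq_square algebra_simps)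
    have n: "n > 0" "n\<^sup>2 = (cmod b)\<^sup>2 + m\<^sup>2"
      using False by (simp_all add: n_def add_pos_nonneg)
    have b: "b = of_real n * p" and m: "m = n * q"
      using n by (simp_all add: p_def q_def)
    have "n\<^sup>2 * ((cmod p)\<^sup>2 + q\<^sup>2) = n\<^sup>2 * 1"
      using n by (simp add: b m norm_mult power_mult_distrib algebra_simps)
    then have "(cmod p)\<^sup>2 + q\<^sup>2 = 1"
      using n(1) by (subst (asm) mult_cancel_left) simp
    then have pq: "p * cnj p + of_real q * of_real q = 1"
      by (metis complex_norm_square of_real_1 of_real_add of_real_mult power2_eq_square)
    \<comment> \<open>Divides \<open>mb\<close> by n to restate it for the normalized
      vector.\<close>
    have "n * (q * (m + a - c)) = n * (n * (cmod p)\<^sup>2)"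
      using mb n by (simp add: b m norm_mult power2_eq_square algebra_simps)
    then have "q * (m + a - c) = n * (cmod p)\<^sup>2"
      using n by simp
    then have "complex_of_real (q * (m + a - c)) = of_real n * (p * cnj p)"
      by (metis complex_norm_square of_real_mult)
    then have qb: "of_real q * (of_real m + of_real a - of_real c) = b * cnj p"
      by (simp add: b mult_ac)
    have qb': "of_real q * b = of_real m * p"
      by (simp add: b m mult_ac)
    have qb'': "cnj b * p = b * cnj p" "cnj b * of_real q = of_real m * cnj p"
      by (simp_all add: b m mult_ac)
    \<comment> \<open>The columns are (p, q) and its orthogonal complement (-q, cnj p). The second
      eigenvalue is c - m because the trace is a + c.\<close>
    define U :: "complex^2^2" where
      "U = (\<chi> i j. if i = 1 then (if j = 1 then p else - of_real q)
                 else (if j = 1 then of_real q else cnj p))"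
    define d :: "2 \<Rightarrow> real" where "d = (\<lambda>i. if i = 1 then m + a else c - m)"
    have "unitary_mat U"
      using pq by (simp add: unitary_mat_def conj_transpose_def U_def mat_def vec_eq_iff forall_2
          matrix_matrix_mult_def sum_2 algebra_simps)
    moreover have "H ** U = U ** diag_mat d"
      using qb qb' qb''
      by (simp add: vec_eq_iff forall_2 matrix_mult_diag_mat d_def)
        (simp add: matrix_matrix_mult_def sum_2 U_def H_entries algebra_simps)
    ultimately show ?thesis by blast
  qed
  then obtain U d where "unitary_mat U" "H ** U = U ** diag_mat d" by blast
  then have "H = U ** diag_mat d ** conj_transpose U"
    unfolding unitary_mat_def by (metis matrix_mul_assoc matrix_mul_rid)
  with \<open>unitary_mat U\<close> show ?thesis by (rule that)
qed

text \<open>The diagonal factor is congruent to \<open>A\<close> via \<open>U\<close>, hence itself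
  positive definite, which forces its entries to be positive.\<close>

lemma pos_def_2_diagonalizable:
  fixes A :: "complex^2^2"
  assumes A: "A \<in> pos_def_mats"
  obtains U d where "unitary_mat U" and "\<forall>i. 0 < d i"
    and "A = U ** diag_mat d ** conj_transpose U"
proof -
  obtain U d where U: "unitary_mat U" and eq: "A = U ** diag_mat d ** conj_transpose U"
    using A hermitian_2_diagonalizable[of A] by (auto simp: pos_def_mats_def)
  have "diag_mat d = conj_transpose U ** A ** U"
    using U unfolding eq unitary_mat_def by (metis matrix_mul_assoc matrix_mul_lid matrix_mul_rid)
  also have "\<dots> \<in> pos_def_mats"
    using U by (intro pos_def_mats_congruence[OF A]) (auto simp: unitary_mat_def)
  finally have "\<forall>i. 0 < d i"
    by (simp add: diag_mat_pos_def_iff)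
  with U eq show ?thesis by (intro that)
qed

section \<open>Laws of real matrix powers\<close>

lemma mat_powr_pos_def:
  fixes A :: "complex^2^2"
  assumes "A \<in> pos_def_mats"
  shows "mat_powr A s \<in> pos_def_mats"
proof -
  obtain U d where *: "unitary_mat U" "\<forall>i. 0 < d i" "A = U ** diag_mat d ** conj_transpose U"
    using pos_def_2_diagonalizable assms by blast
  show ?thesis
    unfolding mat_powr_eq[OF *]
    using *(1,2) by (intro unitary_diag_pos_def) (simp_all add: less_imp_neq[symmetric])
qed

text \<open>By \<open>mat_powr_eq\<close> both powers can be read off one diagonalization, which
  reduces the law to \<open>powr_add\<close> on eigenvalues.\<close>

lemma mat_powr_add:
  fixes A :: "complex^2^2"
  assumes "A \<in> pos_def_mats"
  shows "mat_powr A s ** mat_powr A t = mat_powr A (s + t)"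
proof -
  obtain U d where *: "unitary_mat U" "\<forall>i. 0 < d i" "A = U ** diag_mat d ** conj_transpose U"
    using pos_def_2_diagonalizable assms by blast
  show ?thesis
    unfolding mat_powr_eq[OF *] unitary_conj_mult[OF *(1)] diag_mat_mult by (simp add: powr_add)
qed

lemma mat_powr_0:
  fixes A :: "complex^2^2"
  assumes "A \<in> pos_def_mats"
  shows "mat_powr A 0 = mat 1"
proof -
  obtain U d where *: "unitary_mat U" "\<forall>i. 0 < d i" "A = U ** diag_mat d ** conj_transpose U"
    using pos_def_2_diagonalizable assms by blast
  \<comment> \<open>Needed because \<open>0 powr 0\<close> is 0, not 1.\<close>
  have "d i \<noteq> 0" for i
    using *(2)[rule_format, of i] by simp
  then show ?thesis
    unfolding mat_powr_eq[OF *] using *(1) by (simp add: unitary_mat_def)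
qed

lemma mat_powr_1:
  fixes A :: "complex^2^2"
  assumes "A \<in> pos_def_mats"
  shows "mat_powr A 1 = A"
proof -
  obtain U d where *: "unitary_mat U" "\<forall>i. 0 < d i" "A = U ** diag_mat d ** conj_transpose U"
    using pos_def_2_diagonalizable assms by blast
  have "\<bar>d i\<bar> = d i" for i
    using *(2) by (simp add: less_imp_le)
  then show ?thesis
    unfolding mat_powr_eq[OF *] by (simp flip: *(3))
qed

lemma mat_powr_scaleR:
  fixes A :: "complex^2^2"
  assumes "A \<in> pos_def_mats" and c: "0 < c"
  shows "mat_powr (c *\<^sub>R A) t = (c powr t) *\<^sub>R mat_powr A t"
proof -
  obtain U d where *: "unitary_mat U" "\<forall>i. 0 < d i" "A = U ** diag_mat d ** conj_transpose U"
    using pos_def_2_diagonalizable assms by blast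
  have scale: "r *\<^sub>R (U ** diag_mat e ** conj_transpose U) =
      U ** diag_mat (\<lambda>i. r * e i) ** conj_transpose U" for r e
  proof -
    have "diag_mat (\<lambda>i. r * e i) = r *\<^sub>R (diag_mat e :: complex^2^2)"
      by (simp add: diag_mat_def vec_eq_iff scaleR_conv_of_real[where 'a = complex])
    then show ?thesis
      by (simp add: matrix_mult_scaleR)
  qed
  have "c *\<^sub>R A = U ** diag_mat (\<lambda>i. c * d i) ** conj_transpose U"
    by (simp add: *(3) scale)
  then have "mat_powr (c *\<^sub>R A) t = U ** diag_mat (\<lambda>i. (c * d i) powr t) ** conj_transpose U"
    using * c by (intro mat_powr_eq) auto
  also have "\<dots> = (c powr t) *\<^sub>R mat_powr A t"
    using *(2) c by (simp add: mat_powr_eq[OF *] scale powr_mult less_imp_le)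
  finally show ?thesis .
qed

text \<open>Brings inverses under the power laws, so that positive definiteness of the inverse comes
  for free.\<close>

lemma matrix_inv_eq_mat_powr:
  fixes A :: "complex^2^2"
  assumes "A \<in> pos_def_mats"
  shows "matrix_inv A = mat_powr A (-1)"
  using mat_powr_add[OF assms, of 1 "-1"] mat_powr_add[OF assms, of "-1" 1]
  by (intro matrix_inv_unique) (simp_all add: mat_powr_0 mat_powr_1 assms)

section \<open>Square roots at determinant 1 and the geometric mean\<close>

text \<open>The trace has complex type; the real \<open>r\<close> records that 2 + tr M is a
  positive real, so that \<open>sqrt\<close> and \<open>*\<^sub>R\<close> apply.\<close>

lemma mat_powr_half_det_1:
  fixes M :: "complex^2^2"
  assumes M: "M \<in> pos_def_mats" and det: "det M = 1"
  obtains r where "0 < r" and "of_real r = 2 + trace M"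
    and "mat_powr M (1/2) = (1 / sqrt r) *\<^sub>R (M + mat 1)"
proof -
  obtain U d where *: "unitary_mat U" "\<forall>i. 0 < d i" "M = U ** diag_mat d ** conj_transpose U"
    using pos_def_2_diagonalizable M by blast
  have U: "U ** conj_transpose U = mat 1" "conj_transpose U ** U = mat 1"
    using *(1) by (auto simp: unitary_mat_def)
  have pos: "0 < d 1" "0 < d 2"
    using *(2) by auto
  have "det U * det (conj_transpose U) = 1"
    by (metis U(1) det_I det_mul)
  then have "det M = det (diag_mat d :: complex^2^2)"
    by (simp add: *(3) det_mul mult_ac)
  then have "complex_of_real (d 1 * d 2) = of_real 1"
    using det by (simp add: det_2 diag_mat_def)
  then have prod: "d 1 * d 2 = 1"
    by (simp only: of_real_eq_iff)
  have "trace M = trace (diag_mat d :: complex^2^2)"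
    unfolding *(3) by (metis U(2) matrix_mul_assoc matrix_mul_rid trace_mul_sym)
  also have "\<dots> = of_real (d 1 + d 2)"
    by (simp add: trace_def sum_2 diag_mat_def)
  finally have tr: "of_real (2 + d 1 + d 2) = 2 + trace M"
    by simp
  \<comment> \<open>Stated for x, y so that it serves both eigenvalues, with their roles exchanged;
    x y = 1 turns x (2 + x + y) into (x + 1)^2.\<close>
  have sq: "sqrt x = (x + 1) / sqrt (2 + x + y)" if "0 < x" "0 < y" "x * y = 1" for x y :: real
  proof -
    have "x * (2 + x + y) = (x + 1)\<^sup>2"
      using that by (simp add: power2_eq_square algebra_simps)
    then have "sqrt x * sqrt (2 + x + y) = x + 1"
      using that by (metis real_sqrt_mult real_sqrt_abs abs_of_pos add_pos_pos zero_less_one)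
    then show ?thesis
      using that by (simp add: field_simps)
  qed
  have "d i powr (1/2) = (1 / sqrt (2 + d 1 + d 2)) * (d i + 1)" for i
  proof -
    have "i = 1 \<or> i = 2" using exhaust_2 by blast
    then show ?thesis
      using sq[of "d 1" "d 2"] sq[of "d 2" "d 1"] pos prod by (auto simp: powr_half_sqrt mult_ac add_ac)
  qed
  then have "diag_mat (\<lambda>i. d i powr (1/2)) =
      (1 / sqrt (2 + d 1 + d 2)) *\<^sub>R (diag_mat d + mat 1 :: complex^2^2)"
    by (simp add: diag_mat_def mat_def vec_eq_iff scaleR_conv_of_real[where 'a = complex])
  then have "mat_powr M (1/2) = (1 / sqrt (2 + d 1 + d 2)) *\<^sub>R (M + mat 1)"
    unfolding mat_powr_eq[OF *]
    by (simp add: matrix_mult_scaleR matrix_add_ldistrib matrix_add_rdistrib U *(3))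
  with tr pos show ?thesis
    by (intro that[of "2 + d 1 + d 2"]) auto
qed

lemma geom_mean_inv_det_1:
  fixes A B :: "complex^2^2"
  assumes A: "A \<in> pos_def_mats" and B: "B \<in> pos_def_mats" and det: "det A = 1" "det B = 1"
  obtains r where "0 < r" and "of_real r = 2 + trace (A ** B)"
    and "geom_mean (matrix_inv A) B = (1 / sqrt r) *\<^sub>R (matrix_inv A + B)"
proof -
  define C where "C = matrix_inv A"
  have C: "C \<in> pos_def_mats"
    unfolding C_def matrix_inv_eq_mat_powr[OF A] by (rule mat_powr_pos_def[OF A])
  define P where "P = mat_powr C (1/2)"
  define Q where "Q = mat_powr C (-1/2)"
  have PQ: "P ** Q = mat 1" "Q ** P = mat 1"
    unfolding P_def Q_def mat_powr_add[OF C] by (simp_all add: mat_powr_0 C)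
  have PP: "P ** P = C"
    unfolding P_def mat_powr_add[OF C] by (simp add: mat_powr_1 C)
  have CA: "C ** A = mat 1"
    using mat_powr_add[OF A, of "-1" 1]
    by (simp add: C_def matrix_inv_eq_mat_powr[OF A] mat_powr_0[OF A] mat_powr_1[OF A])
  \<comment> \<open>Q Q = Q Q (C A) = Q Q P P A = A, as Q inverts P.\<close>
  have QQ: "Q ** Q = A"
    using CA PQ PP by (metis matrix_mul_assoc matrix_mul_lid matrix_mul_rid)
  have "conj_transpose Q = Q"
    using mat_powr_pos_def[OF C] unfolding Q_def pos_def_mats_iff by blast
  then have M: "Q ** B ** Q \<in> pos_def_mats"
    using pos_def_mats_congruence[OF B PQ(1)] by simp
  have "det (Q ** B ** Q) = det (Q ** Q) * det B"
    by (simp add: det_mul)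
  then have "det (Q ** B ** Q) = 1"
    by (simp add: QQ det)
  then obtain r where r: "0 < r" "of_real r = 2 + trace (Q ** B ** Q)"
    and half: "mat_powr (Q ** B ** Q) (1/2) = (1 / sqrt r) *\<^sub>R (Q ** B ** Q + mat 1)"
    using mat_powr_half_det_1[OF M] by blast
  \<comment> \<open>Cyclicity of the trace brings the two factors Q together.\<close>
  have "trace (Q ** B ** Q) = trace (A ** B)"
    by (metis QQ matrix_mul_assoc trace_mul_sym)
  moreover have "geom_mean C B = (1 / sqrt r) *\<^sub>R (C + B)"
  proof -
    \<comment> \<open>The outer factors P cancel both Q around B and turn the identity into P P =
      C.\<close>
    have "P ** (Q ** B ** Q + mat 1) ** P = (P ** Q) ** B ** (Q ** P) + P ** P"
      by (simp only: matrix_add_ldistrib matrix_add_rdistrib matrix_mul_assoc matrix_mul_rid)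
    then have "P ** (Q ** B ** Q + mat 1) ** P = C + B"
      by (simp add: PQ PP add.commute)
    then show ?thesis
      unfolding geom_mean_def P_def[symmetric] Q_def[symmetric] half
      by (simp add: matrix_mult_scaleR)
  qed
  ultimately show ?thesis
    using r by (intro that[of r]) (simp_all add: C_def)
qed

theorem proposition5p7:
  fixes A B :: "complex^2^2" and t :: real
  assumes "A \<in> pos_def_mats" and "B \<in> pos_def_mats"
    and "det A = 1" and "det B = 1"
    and "0 \<le> t" and "t \<le> 1"
  shows "spectral_geom_mean t A B =
    (\<chi> i j. (mat_powr (matrix_inv A + B) t ** A ** mat_powr (matrix_inv A + B) t) $ i $ j
              / (2 + trace (A ** B)) powr complex_of_real t)"
proof -
  obtain r where r: "0 < r" "of_real r = 2 + trace (A ** B)"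
    and gm: "geom_mean (matrix_inv A) B = (1 / sqrt r) *\<^sub>R (matrix_inv A + B)"
    using geom_mean_inv_det_1 assms by blast
  \<comment> \<open>The scalar pulled out of each of the two outer powers; the product therefore
    carries k^2 = r^(-t).\<close>
  define k where "k = (1 / sqrt r) powr t"
  have "matrix_inv A + B \<in> pos_def_mats"
    using assms by (simp add: pos_def_mats_add matrix_inv_eq_mat_powr mat_powr_pos_def)
  then have powr: "mat_powr (geom_mean (matrix_inv A) B) t = k *\<^sub>R mat_powr (matrix_inv A + B) t"
    unfolding gm k_def using r by (intro mat_powr_scaleR) auto
  have "k * k = (1 / sqrt r * (1 / sqrt r)) powr t"
    by (simp only: k_def powr_mult)
  also have "\<dots> = 1 / r powr t"
    using r by (simp add: powr_divide)
  finally have kk: "k * k = 1 / r powr t" .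
  \<comment> \<open>The complex power in the claim has the positive real base r, so it agrees with
    the real power.\<close>
  have "(2 + trace (A ** B)) powr complex_of_real t = of_real (r powr t)"
    using r by (simp add: powr_of_real flip: r(2))
  then show ?thesis
    unfolding spectral_geom_mean_def powr
    by (simp add: matrix_mult_scaleR vec_eq_iff kk scaleR_conv_of_real[where 'a = complex])
qed

end
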